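(* Let $M,N,m,k$ be non-negative integers, let $\pi_N$ be a monic polynomial of degree $N$, and let $\big((P_n)_{n\ge0},(Q_n)_{n\ge0}\big)$ be a $\pi_N$-coherent pair with index $M$ and order $(m,k)$, with structure coefficients $c_{n,j}$. Let $\mathbf u$ and $\mathbf v$ be the regular functionals with respect to which $(P_n)_{n\ge0}$ and $(Q_n)_{n\ge0}$, respectively, are orthogonal. Suppose $m\ge k+N$, and assume further that $m>k$ whenever $N=0$. Let $\psi(x;n)$ and $\phi(x;n,j)$ be the polynomials defined in the context. For each $i=0,\ldots,m-k$ and $n=0,1,\ldots$ let $$\varphi(x;n,i):=\sum_{\substack{j+\ell=i\\ 0\le j\le N\\ 0\le \ell\le m-k-N}}\binom{m-k-N}{\ell}\big(\phi(x;n,j)\big)^{(m-k-N-\ell)} .$$ Let $\mathcal A(x):=\big[\varphi(x;n,j)\big]_{n,j=0}^{m-k}$, a polynomial matrix of order $m-k+1$. Let $\mathcal A_1(x)$ (resp. $\mathcal A_2(x)$) be the matrix obtained by replacing the first (resp. the second) column of $\mathcal A(x)$ by $\big[\psi(x;0),\psi(x;1),\ldots,\psi(x;m-k)\big]^t$, and set $A(x):=\det\mathcal A(x)$, $A_1(x):=\det\mathcal A_1(x)$, $A_2(x):=\det\mathcal A_2(x)$. Assume that the polynomial $A$ does not vanish identically. Then $$A\mathbf v=A_1\mathbf u,\qquad A\,D\mathbf v=A_2\mathbf u,$$ hence $\mathbf u$ and $\mathbf v$ are semiclassical functionals related by a rational transformation. Moreover, $\mathbf u$ and $\mathbf v$ satisfy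 $$D(AA_1\mathbf u)=\big(2A'A_1+AA_2\big)\mathbf u,\qquad D(AA_1\mathbf v)=\big((AA_1)'+AA_2\big)\mathbf v .$$
   Context: $\mathcal P$ is the vector space of complex polynomials in one variable; functionals are linear maps $\mathbf w:\mathcal P\to\mathbb C$, with action $\langle\mathbf w,p\rangle$. For a polynomial $\Phi$, $\Phi\mathbf w$ is defined by $\langle\Phi\mathbf w,p\rangle:=\langle\mathbf w,\Phi p\rangle$, and $D\mathbf w$ by $\langle D\mathbf w,p\rangle:=-\langle\mathbf w,p'\rangle$. $f^{(r)}$ is the $r$-th derivative in $x$ of the polynomial $f$. A monic orthogonal polynomial sequence (OPS) with respect to $\mathbf w$ is a sequence $(R_n)_{n\ge0}$ of monic polynomials with $\deg R_n=n$ and $\langle\mathbf w,R_jR_n\rangle=k_n\delta_{j,n}$ with all $k_n\ne0$; $\mathbf w$ is regular if such a sequence exists. Pochhammer symbol: $(\alpha)_0:=1$, $(\alpha)_n:=\alpha(\alpha+1)\cdots(\alpha+n-1)$. Normalized derivatives: $P_n^{[m]}(x):=\frac{1}{(n+1)_m}\frac{d^m}{dx^m}P_{n+m}(x)$ and similarly $Q_n^{[k]}$; these are monic of degree $n$. $\pi_N$-coherent pair with index $M$ and order $(m,k)$: $(P_n)_{n\ge0}$ and $(Q_n)_{n\ge0}$ are two monic OPS for which there are complex numbers $c_{n,j}$ such that $$\pi_N(x)P_n^{[m]}(x)=\sum_{j=n-M}^{n+N}c_{n,j}Q_j^{[k]}(x)\quad(n=0,1,\ldots),$$ with the convention $Q_j^{[k]}\equiv0$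 if $j<0$, and $c_{n,n-M}\ne0$ for all $n\ge M$ (and $c_{n,n+N}=1$ for all $n$, since all polynomials are monic). Polynomials (for $n=0,1,\ldots$ and $j=0,\ldots,N$; in the sum defining $\psi$ terms with negative summation index are taken to be zero): $$\psi(x;n):=\sum_{j=n-N}^{n+M}\frac{(-1)^m(j+1)_m\,c_{j,n}}{\langle\mathbf u,P_{m+j}^2\rangle}P_{m+j}(x),$$ $$\phi(x;n,j):=\frac{(-1)^k(n+1)_k}{\langle\mathbf v,Q_{n+k}^2\rangle}\sum_{\ell=0}^{N-j}\binom{k+N}{\ell}\binom{N-\ell}{N-j-\ell}\pi_N^{(\ell)}(x)\,Q_{n+k}^{(N-j-\ell)}(x).$$ A regular functional $\mathbf w$ is semiclassical if there are nonzero polynomials $\Phi,\Psi$ with $D(\Phi\mathbf w)=\Psi\mathbf w$. Functionals $\mathbf u,\mathbf v$ are related by a rational transformation if there are nonzero polynomials $\Phi,\Psi$ with $\Phi\mathbf u=\Psi\mathbf v$. *)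

theory Defs
  imports
    "HOL-Computational_Algebra.Polynomial"
    "Jordan_Normal_Form.Determinant"
begin

text \<open>Functionals are represented as functions on complex polynomials; linearity is the
  library notion with respect to the scalar multiplications \<^const>\<open>smult\<close> and multiplication
  of complex numbers.\<close>

abbreviation linear_functional :: "(complex poly \<Rightarrow> complex) \<Rightarrow> bool" where
  "linear_functional w \<equiv> Vector_Spaces.linear smult (*) w"

lemma linear_functional_iff:
  "linear_functional w \<longleftrightarrow>
     (\<forall>p q. w (p + q) = w p + w q) \<and> (\<forall>a p. w (smult a p) = a * w p)"
proof
  assume "linear_functional w"
  then interpret Vector_Spaces.linear smult "(*)" w .
  show "(\<forall>p q. w (p + q) = w p + w q) \<and> (\<forall>a p. w (smult a p) = a * w p)"
    by (simp add: add scale)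
next
  assume "(\<forall>p q. w (p + q) = w p + w q) \<and> (\<forall>a p. w (smult a p) = a * w p)"
  then show "linear_functional w"
    by unfold_locales (simp_all add: smult_add_right smult_add_left algebra_simps)
qed

definition fmult :: "complex poly \<Rightarrow> (complex poly \<Rightarrow> complex) \<Rightarrow> complex poly \<Rightarrow> complex"
    (infixr "\<odot>" 75) where
  "\<Phi> \<odot> w = (\<lambda>p. w (\<Phi> * p))"

definition fderiv :: "(complex poly \<Rightarrow> complex) \<Rightarrow> complex poly \<Rightarrow> complex" where
  "fderiv w = (\<lambda>p. - w (pderiv p))"

definition monic_OPS :: "(complex poly \<Rightarrow> complex) \<Rightarrow> (nat \<Rightarrow> complex poly) \<Rightarrow> bool" where
  "monic_OPS w R \<longleftrightarrow> linear_functional w \<and>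
     (\<forall>n. lead_coeff (R n) = 1 \<and> degree (R n) = n) \<and>
     (\<exists>\<kappa> :: nat \<Rightarrow> complex. (\<forall>n. \<kappa> n \<noteq> 0) \<and>
        (\<forall>j n. w (R j * R n) = (if j = n then \<kappa> n else 0)))"

definition regular :: "(complex poly \<Rightarrow> complex) \<Rightarrow> bool" where
  "regular w \<longleftrightarrow> linear_functional w \<and> (\<exists>R. monic_OPS w R)"

definition semiclassical :: "(complex poly \<Rightarrow> complex) \<Rightarrow> bool" where
  "semiclassical w \<longleftrightarrow> regular w \<and>
     (\<exists>\<Phi> \<Psi>. \<Phi> \<noteq> 0 \<and> \<Psi> \<noteq> 0 \<and> fderiv (\<Phi> \<odot> w) = \<Psi> \<odot> w)"

definition rationally_related ::
    "(complex poly \<Rightarrow> complex) \<Rightarrow> (complex poly \<Rightarrow> complex) \<Rightarrow> bool" where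
  "rationally_related u v \<longleftrightarrow> (\<exists>\<Phi> \<Psi>. \<Phi> \<noteq> 0 \<and> \<Psi> \<noteq> 0 \<and> \<Phi> \<odot> u = \<Psi> \<odot> v)"

definition nderiv :: "nat \<Rightarrow> (nat \<Rightarrow> complex poly) \<Rightarrow> nat \<Rightarrow> complex poly" where
  "nderiv m P n = smult (1 / pochhammer (of_nat (n + 1)) m) ((pderiv ^^ m) (P (n + m)))"

text \<open>The coefficients \<open>c n j\<close> are indexed by natural numbers. The truncated subtraction \<open>n - M\<close>
  in the lower summation bound drops exactly the terms with negative index, for which the
  polynomial \<open>Q\<^sub>j\<close> is zero by convention. That \<open>c n (n + N) = 1\<close> when the polynomials
  are monic and \<open>\<pi>\<close> has degree \<open>N\<close> follows by comparing leading coefficients.\<close>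

definition coherent_pair ::
    "complex poly \<Rightarrow> nat \<Rightarrow> nat \<Rightarrow> nat \<Rightarrow> nat \<Rightarrow> (nat \<Rightarrow> complex poly) \<Rightarrow> (nat \<Rightarrow> complex poly) \<Rightarrow>
     (nat \<Rightarrow> nat \<Rightarrow> complex) \<Rightarrow> bool" where
  "coherent_pair \<pi> N M m k P Q c \<longleftrightarrow>
     (\<exists>u. monic_OPS u P) \<and> (\<exists>v. monic_OPS v Q) \<and>
     (\<forall>n. \<pi> * nderiv m P n = (\<Sum>j = n - M..n + N. smult (c n j) (nderiv k Q j))) \<and>
     (\<forall>n\<ge>M. c n (n - M) \<noteq> 0)"

text \<open>Again truncated subtraction in the lower bound drops the terms with negative index.\<close>

definition psi ::
    "(complex poly \<Rightarrow> complex) \<Rightarrow> (nat \<Rightarrow> complex poly) \<Rightarrow> (nat \<Rightarrow> nat \<Rightarrow> complex) \<Rightarrow>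
     nat \<Rightarrow> nat \<Rightarrow> nat \<Rightarrow> nat \<Rightarrow> complex poly" where
  "psi u P c N M m n =
     (\<Sum>j = n - N..n + M.
        smult ((- 1) ^ m * pochhammer (of_nat (j + 1)) m * c j n / u ((P (m + j))\<^sup>2)) (P (m + j)))"

definition phi ::
    "(complex poly \<Rightarrow> complex) \<Rightarrow> (nat \<Rightarrow> complex poly) \<Rightarrow> complex poly \<Rightarrow>
     nat \<Rightarrow> nat \<Rightarrow> nat \<Rightarrow> nat \<Rightarrow> complex poly" where
  "phi v Q \<pi> N k n j =
     smult ((- 1) ^ k * pochhammer (of_nat (n + 1)) k / v ((Q (n + k))\<^sup>2))
       (\<Sum>l = 0..N - j.
          of_nat ((k + N) choose l) * of_nat ((N - l) choose (N - j - l)) *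
          (pderiv ^^ l) \<pi> * (pderiv ^^ (N - j - l)) (Q (n + k)))"

definition varphi ::
    "(complex poly \<Rightarrow> complex) \<Rightarrow> (nat \<Rightarrow> complex poly) \<Rightarrow> complex poly \<Rightarrow>
     nat \<Rightarrow> nat \<Rightarrow> nat \<Rightarrow> nat \<Rightarrow> nat \<Rightarrow> complex poly" where
  "varphi v Q \<pi> N m k n i =
     (\<Sum>(j, l) \<in> {(j, l). j + l = i \<and> j \<le> N \<and> l \<le> m - k - N}.
        of_nat ((m - k - N) choose l) * (pderiv ^^ (m - k - N - l)) (phi v Q \<pi> N k n j))"

definition varphi_mat ::
    "(complex poly \<Rightarrow> complex) \<Rightarrow> (nat \<Rightarrow> complex poly) \<Rightarrow> complex poly \<Rightarrow>
     nat \<Rightarrow> nat \<Rightarrow> nat \<Rightarrow> complex poly mat" where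
  "varphi_mat v Q \<pi> N m k =
     mat (m - k + 1) (m - k + 1) (\<lambda>(n, i). varphi v Q \<pi> N m k n i)"

definition psi_vec ::
    "(complex poly \<Rightarrow> complex) \<Rightarrow> (nat \<Rightarrow> complex poly) \<Rightarrow> (nat \<Rightarrow> nat \<Rightarrow> complex) \<Rightarrow>
     nat \<Rightarrow> nat \<Rightarrow> nat \<Rightarrow> nat \<Rightarrow> complex poly vec" where
  "psi_vec u P c N M m k = vec (m - k + 1) (psi u P c N M m)"

end

theory Submission
  imports Defs
begin

text \<open>The functionals \<open>b\<^sub>n\<close> dual to the normalized derivatives of order \<open>k\<close> of \<open>Q\<close> satisfy
  \<open>D\<^sup>k b\<^sub>n = const \<cdot> Q\<^sub>n\<^sub>+\<^sub>k v\<close>. Pairing \<open>D\<^sup>m (\<pi> b\<^sub>n)\<close> with the basis \<open>P\<close> and using coherence gives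
  \<open>\<psi>(\<cdot>; n) u\<close>, while two applications of the Leibniz rule give \<open>\<Sum>\<^sub>i varphi(\<cdot>; n, i) D\<^sup>i v\<close>, where only
  \<open>D\<^sup>k b\<^sub>n\<close> is needed because \<open>\<pi>\<close> has degree \<open>N\<close>. This is a linear system for
  \<open>v, D v, \<dots>, D\<^sup>m\<^sup>-\<^sup>k v\<close>, solved by Cramer's rule over the polynomial ring, which acts on
  functionals. The coefficients of the resulting Pearson equations are nonzero because a regular
  functional has no polynomial torsion and every polynomial is a derivative.\<close>

section \<open>Calculus of functionals: linearity, iterated derivatives, Leibniz rule\<close>

context
  fixes w :: "complex poly \<Rightarrow> complex"
  assumes w: "linear_functional w"
begin

interpretation Vector_Spaces.linear smult "(*)" w by (rule w)

lemma functional_simps: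
  "w 0 = 0" "w (p + q) = w p + w q" "w (p - q) = w p - w q" "w (- p) = - w p"
  "w (smult a p) = a * w p" "w (of_nat i * p) = of_nat i * w p"
  by (simp_all add: zero add diff neg scale of_nat_poly)

lemma functional_sum: "w (\<Sum>i\<in>I. f i) = (\<Sum>i\<in>I. w (f i))"
  by (rule sum)

lemma linear_functional_fmult: "linear_functional (\<Phi> \<odot> w)"
  by (simp add: linear_functional_iff fmult_def algebra_simps functional_simps)

lemma linear_functional_fderiv: "linear_functional (fderiv w)"
  by (simp add: linear_functional_iff fderiv_def pderiv_add pderiv_smult functional_simps)

lemma fderiv_fmult: "fderiv (\<Phi> \<odot> w) p = (pderiv \<Phi> \<odot> w) p + (\<Phi> \<odot> fderiv w) p"
  by (simp add: fderiv_def fmult_def pderiv_mult functional_simps mult.commute)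

end

lemma linear_functional_fderiv_pow:
  "linear_functional w \<Longrightarrow> linear_functional ((fderiv ^^ n) w)"
  by (induction n) (simp_all add: linear_functional_fderiv)

lemma fderiv_pow: "(fderiv ^^ n) w p = (- 1) ^ n * w ((pderiv ^^ n) p)"
  by (induction n arbitrary: p) (simp_all add: fderiv_def[of "(fderiv ^^ _) w"] funpow_swap1[of pderiv])

lemma fderiv_pow_add:
  "(fderiv ^^ n) (\<lambda>p. w\<^sub>1 p + w\<^sub>2 p) p = (fderiv ^^ n) w\<^sub>1 p + (fderiv ^^ n) w\<^sub>2 p"
  by (simp add: fderiv_pow algebra_simps)

text \<open>Pascal's rule summed against an arbitrary \<open>T\<close>. It closes the induction for
  the Leibniz formula, where \<open>T l\<close> collects the term with \<open>l\<close> derivatives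
  on the functional.\<close>

lemma sum_choose_Suc:
  fixes T :: "nat \<Rightarrow> 'a :: comm_semiring_1"
  shows "(\<Sum>l\<le>Suc n. of_nat (Suc n choose l) * T l) =
    (\<Sum>l\<le>n. of_nat (n choose l) * T l) + (\<Sum>l\<le>n. of_nat (n choose l) * T (Suc l))"
proof -
  have "(\<Sum>l\<le>n. of_nat (n choose l) * T l) = (\<Sum>l\<le>Suc n. of_nat (n choose l) * T l)"
    by (simp add: binomial_eq_0)
  also have "\<dots> = T 0 + (\<Sum>l\<le>n. of_nat (n choose Suc l) * T (Suc l))"
    by (subst sum.atMost_Suc_shift) simp
  finally show ?thesis
    by (subst sum.atMost_Suc_shift) (simp add: sum.distrib algebra_simps)
qed

text \<open>The induction peels off the innermost derivation, which turns \<Phi> into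
  \<open>pderiv \<Phi>\<close> or \<open>w\<close> into \<open>fderiv w\<close>; hence both are
  generalized.\<close>

lemma fderiv_pow_fmult:
  assumes "linear_functional w"
  shows "(fderiv ^^ n) (\<Phi> \<odot> w) p =
    (\<Sum>l\<le>n. of_nat (n choose l) * (fderiv ^^ l) w ((pderiv ^^ (n - l)) \<Phi> * p))"
  using assms
proof (induction n arbitrary: \<Phi> w)
  case 0
  then show ?case by (simp add: fmult_def)
next
  case (Suc n)
  have "fderiv (\<Phi> \<odot> w) = (\<lambda>p. (pderiv \<Phi> \<odot> w) p + (\<Phi> \<odot> fderiv w) p)"
    using fderiv_fmult[OF Suc.prems] by blast
  then have "(fderiv ^^ Suc n) (\<Phi> \<odot> w) p =
      (fderiv ^^ n) (pderiv \<Phi> \<odot> w) p + (fderiv ^^ n) (\<Phi> \<odot> fderiv w) p"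
    by (simp add: funpow_swap1 fderiv_pow_add del: funpow.simps(2) add: funpow_Suc_right)
  also have "(fderiv ^^ n) (pderiv \<Phi> \<odot> w) p =
      (\<Sum>l\<le>n. of_nat (n choose l) * (fderiv ^^ l) w ((pderiv ^^ (Suc n - l)) \<Phi> * p))"
    by (subst Suc.IH[OF Suc.prems]) (intro sum.cong refl, simp add: Suc_diff_le funpow_swap1)
  also have "(fderiv ^^ n) (\<Phi> \<odot> fderiv w) p = (\<Sum>l\<le>n. of_nat (n choose l) *
      (fderiv ^^ Suc l) w ((pderiv ^^ (Suc n - Suc l)) \<Phi> * p))"
    by (subst Suc.IH[OF linear_functional_fderiv[OF Suc.prems]]) (simp add: funpow_swap1)
  finally show ?case by (simp only: sum_choose_Suc)
qed

section \<open>Antiderivatives of polynomials and of functionals\<close>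

lemma pderiv_surj: "\<exists>q. pderiv q = (p :: 'a :: field_char_0 poly)"
proof -
  let ?q = "\<Sum>i\<le>Polynomial.degree p. Polynomial.monom (coeff p i / of_nat (Suc i)) (Suc i)"
  have "pderiv ?q = (\<Sum>i\<le>Polynomial.degree p. Polynomial.monom (coeff p i) i)"
    using higher_pderiv_sum[of 1 "\<lambda>i. Polynomial.monom (coeff p i / of_nat (Suc i)) (Suc i)"]
    by (simp add: pderiv_monom del: of_nat_Suc)
  then show ?thesis by (metis poly_as_sum_of_monoms)
qed

text \<open>The witness sends \<open>p\<close> to minus the value of \<open>w\<close> at an
  antiderivative of \<open>p\<close>. Antiderivatives differ by constants, on which \<open>w\<close>
  vanishes because \<open>w 1 = 0\<close>.\<close>

lemma fderiv_surj:
  assumes w: "linear_functional w" and "w 1 = 0"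
  shows "\<exists>w'. linear_functional w' \<and> fderiv w' = w"
proof -
  \<comment> \<open>The choice \<open>I\<close> need not be linear; only its composition with
    \<open>w\<close> is shown to be, through \<open>eq\<close>.\<close>
  define I where "I p = (SOME q. pderiv q = p)" for p :: "complex poly"
  have I: "pderiv (I p) = p" for p
    unfolding I_def using pderiv_surj by (rule someI_ex)
  have eq: "w p = w q" if "pderiv p = pderiv q" for p q
  proof -
    have "pderiv (p - q) = 0" using that by (simp add: pderiv_diff)
    then obtain h where "p - q = [:h:]" using pderiv_iszero by blast
    moreover have "w [:h:] = h * w 1"
      using functional_simps(5)[OF w, of h 1] by simp
    ultimately have "w (p - q) = 0" using \<open>w 1 = 0\<close> by simp
    then show ?thesis by (simp add: functional_simps[OF w])
  qed
  have "w (I (p + q)) = w (I p + I q)" for p q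
    by (rule eq) (simp add: I pderiv_add)
  moreover have "w (I (smult a p)) = w (smult a (I p))" for a p
    by (rule eq) (simp add: I pderiv_smult)
  ultimately have "linear_functional (\<lambda>p. - w (I p))"
    by (simp add: linear_functional_iff functional_simps[OF w])
  moreover have "w (I (pderiv p)) = w p" for p
    by (rule eq) (simp add: I)
  then have "fderiv (\<lambda>p. - w (I p)) = w"
    by (simp add: fderiv_def)
  ultimately show ?thesis by blast
qed

text \<open>Each integration lowers the bound by one: a polynomial of degree below \<open>k\<close>
  has an antiderivative of degree below \<open>Suc k\<close>, where \<open>w\<close> vanishes, so
  the integrated functional still satisfies the hypothesis for \<open>k\<close>.\<close>

lemma fderiv_pow_surj:
  assumes "linear_functional w" and "\<And>p. Polynomial.degree p < k \<Longrightarrow> w p = 0"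
  shows "\<exists>w'. linear_functional w' \<and> (fderiv ^^ k) w' = w"
  using assms
proof (induction k arbitrary: w)
  case 0
  then show ?case by auto
next
  case (Suc k)
  from Suc.prems(2)[of 1] obtain w\<^sub>1 where w1: "linear_functional w\<^sub>1" "fderiv w\<^sub>1 = w"
    using fderiv_surj[OF Suc.prems(1)] by auto
  have "w\<^sub>1 p = 0" if "Polynomial.degree p < k" for p
  proof -
    obtain q where q: "pderiv q = p" using pderiv_surj by blast
    then have "Polynomial.degree q < Suc k" using that degree_pderiv[of q] by simp
    then have "fderiv w\<^sub>1 q = 0" using Suc.prems(2) w1(2) by simp
    then show ?thesis by (simp add: fderiv_def q)
  qed
  then obtain w' where "linear_functional w'" "(fderiv ^^ k) w' = w\<^sub>1"
    using Suc.IH w1(1) by blast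
  then show ?case using w1(2) by auto
qed

section \<open>Monic bases and orthogonal polynomial sequences\<close>

lemma functional_eq_0_on_monic_basis:
  assumes f: "linear_functional f"
    and R: "\<And>n. lead_coeff (R n) = 1" "\<And>n. Polynomial.degree (R n) = n"
    and "\<And>i. i < d \<Longrightarrow> f (R i) = 0" and "Polynomial.degree p < d"
  shows "f p = 0"
  using assms(4,5)
proof (induction d arbitrary: p)
  case 0
  then show ?case by simp
next
  case (Suc d)
  \<comment> \<open>This multiple of \<open>R d\<close> cancels the coefficient of degree
    \<open>d\<close>, so the remainder falls under the induction hypothesis.\<close>
  define r where "r = p - smult (coeff p d) (R d)"
  have "f r = 0"
  proof (cases "r = 0")
    case True
    then show ?thesis by (simp add: functional_simps[OF f])
  next
    case False
    have "coeff r i = 0" if "d \<le> i" for i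
    proof (cases "i = d")
      case True
      have "coeff (R d) d = 1" using R[of d] by simp
      then show ?thesis by (simp add: r_def True)
    next
      case False
      with that have "d < i" by simp
      then show ?thesis using Suc.prems(2) R(2)[of d] by (simp add: r_def coeff_eq_0)
    qed
    then have "Polynomial.degree r < d"
      using False by (metis leading_coeff_0_iff not_le)
    then show ?thesis using Suc by simp
  qed
  then show ?case
    using Suc.prems(1)[of d] by (simp add: r_def functional_simps[OF f])
qed

lemma functional_eqI_monic_basis:
  assumes f: "linear_functional f" and g: "linear_functional g"
    and R: "\<And>n. lead_coeff (R n) = 1" "\<And>n. Polynomial.degree (R n) = n"
    and eq: "\<And>i. f (R i) = g (R i)"
  shows "f = g"
proof
  fix p
  have "linear_functional (\<lambda>p. f p - g p)"
    by (simp add: linear_functional_iff functional_simps[OF f] functional_simps[OF g]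
        algebra_simps)
  from functional_eq_0_on_monic_basis[OF this R, of "Suc (Polynomial.degree p)" p]
  show "f p = g p" by (simp add: eq)
qed

context
  fixes w R
  assumes OPS: "monic_OPS w R"
begin

lemma monic_OPS_linear: "linear_functional w"
  using OPS by (simp add: monic_OPS_def)

lemma monic_OPS_degree: "Polynomial.degree (R n) = n"
  using OPS by (simp add: monic_OPS_def)

lemma monic_OPS_lead_coeff: "lead_coeff (R n) = 1"
  using OPS unfolding monic_OPS_def by blast

lemma monic_OPS_orthogonal: "i \<noteq> j \<Longrightarrow> w (R i * R j) = 0"
  using OPS by (auto simp: monic_OPS_def)

lemma monic_OPS_norm: "w ((R n)\<^sup>2) \<noteq> 0"
  using OPS by (auto simp: monic_OPS_def power2_eq_square)

lemma monic_OPS_lower_degree: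
  assumes "Polynomial.degree p < n" shows "w (R n * p) = 0"
  using functional_eq_0_on_monic_basis[OF linear_functional_fmult[OF monic_OPS_linear]
      monic_OPS_lead_coeff monic_OPS_degree _ assms, of "R n"] monic_OPS_orthogonal
  by (simp add: fmult_def)

text \<open>Testing against \<open>R d\<close>, with \<open>d\<close> the degree of \<Phi>, leaves
  only the leading coefficient times the nonzero norm of \<open>R d\<close>; the lower part of
  \<Phi> is orthogonal to \<open>R d\<close>.\<close>

lemma monic_OPS_torsion_free:
  assumes "\<And>p. w (\<Phi> * p) = 0" shows "\<Phi> = 0"
proof (rule ccontr)
  assume "\<Phi> \<noteq> 0"
  define d where "d = Polynomial.degree \<Phi>"
  define r where "r = \<Phi> - smult (lead_coeff \<Phi>) (R d)"
  have "w (R d * r) = 0"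
  proof (cases "r = 0")
    case True
    then show ?thesis by (simp add: functional_simps[OF monic_OPS_linear])
  next
    case False
    have "Polynomial.degree r \<le> d" "coeff r d = 0"
      using monic_OPS_degree[of d] monic_OPS_lead_coeff[of d]
      by (auto simp: r_def d_def intro!: degree_diff_le order.trans[OF degree_smult_le])
    then have "Polynomial.degree r < d"
      using False by (metis leading_coeff_0_iff le_neq_implies_less)
    then show ?thesis by (rule monic_OPS_lower_degree)
  qed
  moreover have "\<Phi> * R d = R d * r + smult (lead_coeff \<Phi>) ((R d)\<^sup>2)"
    by (simp add: r_def algebra_simps power2_eq_square)
  ultimately have "w (\<Phi> * R d) = lead_coeff \<Phi> * w ((R d)\<^sup>2)"
    by (simp add: functional_simps[OF monic_OPS_linear])
  then show False
    using assms[of "R d"] monic_OPS_norm[of d] \<open>\<Phi> \<noteq> 0\<close> by simp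
qed

lemma monic_OPS_regular: "regular w"
  using OPS monic_OPS_linear by (auto simp: regular_def)

text \<open>Nonvanishing of \<Psi> is automatic: otherwise \<open>\<Phi> \<odot> w\<close> would
  kill every derivative, hence every polynomial, against torsion-freeness.\<close>

lemma monic_OPS_semiclassicalI:
  assumes "\<Phi> \<noteq> 0" and "fderiv (\<Phi> \<odot> w) = \<Psi> \<odot> w"
  shows "semiclassical w"
proof -
  have "\<Psi> \<noteq> 0"
  proof
    assume "\<Psi> = 0"
    have "w (\<Phi> * p) = 0" for p
    proof -
      obtain q where "pderiv q = p" using pderiv_surj by blast
      moreover have "fderiv (\<Phi> \<odot> w) q = 0"
        unfolding assms(2) \<open>\<Psi> = 0\<close> by (simp add: fmult_def functional_simps[OF monic_OPS_linear])
      ultimately show ?thesis by (simp add: fderiv_def fmult_def)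
    qed
    then show False using monic_OPS_torsion_free \<open>\<Phi> \<noteq> 0\<close> by blast
  qed
  then show ?thesis using assms monic_OPS_regular by (auto simp: semiclassical_def)
qed

end

section \<open>Functionals dual to the normalized derivatives, and coherence\<close>

lemma pochhammer_of_nat_Suc_neq_0: "pochhammer (of_nat (n + 1)) k \<noteq> (0 :: complex)"
  using pochhammer_pos[of "n + 1" k] by (simp only: pochhammer_of_nat of_nat_eq_0_iff) simp

lemma higher_pderiv_eq_smult_nderiv:
  "(pderiv ^^ m) (P (n + m)) = smult (pochhammer (of_nat (n + 1)) m) (nderiv m P n)"
  unfolding nderiv_def smult_smult
  using pochhammer_of_nat_Suc_neq_0[of n m] by simp

text \<open>The right-hand side of the last equation vanishes below degree \<open>k\<close> by
  orthogonality, so it can be integrated \<open>k\<close> times. Evaluating at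
  \<open>Q (j + k)\<close> then gives the duality; the constant is chosen to make the value at
  \<open>j = n\<close> equal to 1.\<close>

lemma nderiv_dual_functional:
  assumes OPS: "monic_OPS v Q"
  obtains b where "linear_functional b"
    and "\<And>j. b (nderiv k Q j) = (if j = n then 1 else 0)"
    and "(fderiv ^^ k) b =
      smult ((- 1) ^ k * pochhammer (of_nat (n + 1)) k / v ((Q (n + k))\<^sup>2)) (Q (n + k)) \<odot> v"
proof -
  define a where "a = (- 1) ^ k * pochhammer (of_nat (n + 1)) k / v ((Q (n + k))\<^sup>2)"
  let ?w = "smult a (Q (n + k)) \<odot> v"
  note v = monic_OPS_linear[OF OPS]
  have "?w p = 0" if "Polynomial.degree p < k" for p
    using monic_OPS_lower_degree[OF OPS, of p "n + k"] that
    by (simp add: fmult_def functional_simps[OF v])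
  then obtain b where b: "linear_functional b" "(fderiv ^^ k) b = ?w"
    using fderiv_pow_surj[OF linear_functional_fmult[OF v]] by blast
  have "b (nderiv k Q j) = (if j = n then 1 else 0)" for j
  proof -
    have "(- 1) ^ k * b ((pderiv ^^ k) (Q (j + k))) = ?w (Q (j + k))"
      by (simp add: b(2)[symmetric] fderiv_pow)
    then have "(- 1) ^ k * (pochhammer (of_nat (j + 1)) k * b (nderiv k Q j)) =
        a * v (Q (n + k) * Q (j + k))"
      unfolding higher_pderiv_eq_smult_nderiv fmult_def mult_smult_left
        functional_simps(5)[OF v] functional_simps(5)[OF b(1)] .
    moreover have "a * v (Q (n + k) * Q (j + k)) =
        (if j = n then (- 1) ^ k * pochhammer (of_nat (n + 1)) k else 0)"
      using monic_OPS_orthogonal[OF OPS, of "n + k" "j + k"] monic_OPS_norm[OF OPS, of "n + k"]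
      by (simp add: a_def power2_eq_square)
    ultimately show ?thesis
      using pochhammer_of_nat_Suc_neq_0[of j k] by (auto split: if_splits)
  qed
  then show thesis using that b unfolding a_def by blast
qed

text \<open>Both sides are compared on the basis \<open>P\<close>. For index below \<open>m\<close>
  both vanish, by degree and by orthogonality; at \<open>j + m\<close> coherence and duality extract
  the coefficient \<open>c j n\<close>.\<close>

lemma fderiv_pow_coherent_dual:
  assumes coherent: "coherent_pair \<pi> N M m k P Q c" and OPS: "monic_OPS u P"
    and b: "linear_functional b" "\<And>j. b (nderiv k Q j) = (if j = n then 1 else 0)"
  shows "(fderiv ^^ m) (\<pi> \<odot> b) = psi u P c N M m n \<odot> u"
proof (rule functional_eqI_monic_basis[OF _ _ monic_OPS_lead_coeff monic_OPS_degree])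
  note u = monic_OPS_linear[OF OPS]
  show "monic_OPS u P" "monic_OPS u P" by (fact OPS)+
  show "linear_functional ((fderiv ^^ m) (\<pi> \<odot> b))"
    by (intro linear_functional_fderiv_pow linear_functional_fmult b)
  show "linear_functional (psi u P c N M m n \<odot> u)"
    by (intro linear_functional_fmult u)
  fix i
  have psi: "(psi u P c N M m n \<odot> u) (P i) =
      (\<Sum>j = n - N..n + M. (- 1) ^ m * pochhammer (of_nat (j + 1)) m * c j n /
         u ((P (m + j))\<^sup>2) * u (P (m + j) * P i))"
    by (simp add: psi_def fmult_def sum_distrib_right functional_sum[OF u] functional_simps[OF u])
  show "(fderiv ^^ m) (\<pi> \<odot> b) (P i) = (psi u P c N M m n \<odot> u) (P i)"
  proof (cases "i < m")
    case True
    have "(pderiv ^^ m) (P i) = 0"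
      using True
      by (intro poly_eqI) (simp add: coeff_higher_pderiv coeff_eq_0 monic_OPS_degree[OF OPS])
    then have "(fderiv ^^ m) (\<pi> \<odot> b) (P i) = 0"
      by (simp add: fderiv_pow fmult_def functional_simps[OF b(1)])
    moreover have "u (P (m + j) * P i) = 0" for j
      using monic_OPS_orthogonal[OF OPS, of "m + j" i] True by simp
    ultimately show ?thesis by (simp add: psi)
  next
    case False
    then obtain j where i: "i = j + m" by (metis add.commute le_Suc_ex not_less)
    have "b (\<pi> * nderiv m P j) = (\<Sum>l = j - M..j + N. c j l * b (nderiv k Q l))"
      using coherent
      by (simp add: coherent_pair_def functional_sum[OF b(1)] functional_simps[OF b(1)])
    \<comment> \<open>The index \<open>n\<close> lies in \<open>{j - M..j + N}\<close> iff
      \<open>j\<close> lies in \<open>{n - N..n + M}\<close>, also when the subtractions are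
      truncated.\<close>
    also have "\<dots> = (if j \<in> {n - N..n + M} then c j n else 0)"
      by (auto simp: b(2) if_distrib cong: if_cong)
    finally have "(fderiv ^^ m) (\<pi> \<odot> b) (P i) = (- 1) ^ m * (pochhammer (of_nat (j + 1)) m *
        (if j \<in> {n - N..n + M} then c j n else 0))"
      unfolding i fderiv_pow fmult_def higher_pderiv_eq_smult_nderiv mult_smult_right
        functional_simps(5)[OF b(1)] by simp
    moreover have "(psi u P c N M m n \<odot> u) (P i) =
        (\<Sum>l = n - N..n + M. if j = l then (- 1) ^ m * pochhammer (of_nat (j + 1)) m * c j n else 0)"
      unfolding psi
    proof (intro sum.cong refl)
      fix l
      show "(- 1) ^ m * pochhammer (of_nat (l + 1)) m * c l n / u ((P (m + l))\<^sup>2) *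
          u (P (m + l) * P i) =
        (if j = l then (- 1) ^ m * pochhammer (of_nat (j + 1)) m * c j n else 0)"
        using monic_OPS_orthogonal[OF OPS, of "m + l" i] monic_OPS_norm[OF OPS, of "m + l"]
        by (auto simp: i power2_eq_square add.commute)
    qed
    ultimately show ?thesis by simp
  qed
qed

section \<open>Leibniz expansions producing \<open>phi\<close> and \<open>varphi\<close>\<close>

lemma sum_triangle_swap:
  fixes f :: "nat \<Rightarrow> nat \<Rightarrow> 'a :: comm_monoid_add"
  shows "(\<Sum>i\<le>n. \<Sum>j\<le>n - i. f i j) = (\<Sum>j\<le>n. \<Sum>i\<le>n - j. f i j)"
  unfolding sum.Sigma[OF finite_atMost ballI[OF finite_atMost]]
  by (rule sum.reindex_bij_witness[of _ prod.swap prod.swap]) auto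

text \<open>At most \<open>N\<close> of the \<open>k + N\<close> derivatives can fall on \<pi>, so
  at least \<open>k\<close> fall on \<open>b\<close> and \<open>dual\<close> applies. The remaining
  \<open>N - l\<close> are expanded by a second Leibniz rule, and terms are collected by the order
  \<open>j\<close> of the derivative of \<open>v\<close>.\<close>

lemma fderiv_pow_dual_phi:
  assumes v: "linear_functional v" and b: "linear_functional b" and \<pi>: "Polynomial.degree \<pi> = N"
    and dual: "(fderiv ^^ k) b =
      smult ((- 1) ^ k * pochhammer (of_nat (n + 1)) k / v ((Q (n + k))\<^sup>2)) (Q (n + k)) \<odot> v"
  shows "(fderiv ^^ (k + N)) (\<pi> \<odot> b) p = (\<Sum>j\<le>N. (fderiv ^^ j) v (phi v Q \<pi> N k n j * p))"
proof -
  define a where "a = (- 1) ^ k * pochhammer (of_nat (n + 1)) k / v ((Q (n + k))\<^sup>2)"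
  define q where "q = Q (n + k)"
  define V where "V j = (fderiv ^^ j) v" for j
  note V = linear_functional_fderiv_pow[OF v, folded V_def]
  define T where "T l j = of_nat ((k + N) choose l) * of_nat ((N - l) choose j) *
    (a * V j ((pderiv ^^ l) \<pi> * (pderiv ^^ (N - j - l)) q * p))" for l j
  \<comment> \<open>The Leibniz sum is reversed so that \<open>l\<close> counts the derivatives on
    \<pi>, as in \<open>phi\<close>.\<close>
  have "(fderiv ^^ (k + N)) (\<pi> \<odot> b) p =
      (\<Sum>l\<le>k + N. of_nat ((k + N) choose l) * (fderiv ^^ (k + N - l)) b ((pderiv ^^ l) \<pi> * p))"
    unfolding fderiv_pow_fmult[OF b]
    by (rule sum.reindex_bij_witness[of _ "\<lambda>l. k + N - l" "\<lambda>l. k + N - l"])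
      (auto simp: binomial_symmetric[symmetric])
  also have "\<dots> =
      (\<Sum>l\<le>N. of_nat ((k + N) choose l) * (fderiv ^^ (k + N - l)) b ((pderiv ^^ l) \<pi> * p))"
  proof (intro sum.mono_neutral_right ballI)
    fix l assume "l \<in> {..k + N} - {..N}"
    then have "(pderiv ^^ l) \<pi> = 0"
      by (intro poly_eqI) (simp add: coeff_higher_pderiv coeff_eq_0 \<pi>)
    then show "of_nat ((k + N) choose l) * (fderiv ^^ (k + N - l)) b ((pderiv ^^ l) \<pi> * p) = 0"
      by (simp add: functional_simps[OF linear_functional_fderiv_pow[OF b]])
  qed auto
  also have "\<dots> = (\<Sum>l\<le>N. \<Sum>j\<le>N - l. T l j)"
  proof (intro sum.cong refl)
    fix l assume "l \<in> {..N}"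
    then have "k + N - l = N - l + k" by simp
    then have "(fderiv ^^ (k + N - l)) b = (fderiv ^^ (N - l)) (smult a q \<odot> v)"
      by (simp only: funpow_add o_apply dual a_def q_def)
    then show "of_nat ((k + N) choose l) * (fderiv ^^ (k + N - l)) b ((pderiv ^^ l) \<pi> * p) =
        (\<Sum>j\<le>N - l. T l j)"
      by (simp add: fderiv_pow_fmult[OF v] T_def sum_distrib_left higher_pderiv_smult
          V_def[symmetric] functional_simps[OF V] add.commute[of l] mult_ac)
  qed
  also have "\<dots> = (\<Sum>j\<le>N. \<Sum>l\<le>N - j. T l j)"
    by (rule sum_triangle_swap)
  also have "\<dots> = (\<Sum>j\<le>N. V j (phi v Q \<pi> N k n j * p))"
  proof (intro sum.cong refl)
    fix j assume "j \<in> {..N}"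
    have "V j (phi v Q \<pi> N k n j * p) = a * (\<Sum>l\<le>N - j. of_nat ((k + N) choose l) *
        (of_nat ((N - l) choose (N - j - l)) *
          V j ((pderiv ^^ l) \<pi> * (pderiv ^^ (N - j - l)) q * p)))"
      by (simp add: phi_def a_def q_def sum_distrib_right mult.assoc
          functional_sum[OF V] functional_simps[OF V] atLeast0AtMost)
    also have "\<dots> = (\<Sum>l\<le>N - j. T l j)"
      unfolding sum_distrib_left
    proof (intro sum.cong refl)
      fix l assume "l \<in> {..N - j}"
      then have "(N - l) choose (N - j - l) = (N - l) choose j"
        using \<open>j \<in> {..N}\<close> binomial_symmetric[of j "N - l"] by (simp add: add.commute)
      then show "a * (of_nat ((k + N) choose l) * (of_nat ((N - l) choose (N - j - l)) *
          V j ((pderiv ^^ l) \<pi> * (pderiv ^^ (N - j - l)) q * p))) = T l j"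
        by (simp add: T_def mult_ac)
    qed
    finally show "(\<Sum>l\<le>N - j. T l j) = V j (phi v Q \<pi> N k n j * p)" ..
  qed
  finally show ?thesis by (simp add: V_def)
qed

text \<open>The \<open>m - k - N\<close> derivatives beyond the order \<open>k + N\<close> are
  distributed by a third Leibniz rule, and terms are grouped by the total order
  \<open>i = j + l\<close> on \<open>v\<close>.\<close>

lemma fderiv_pow_dual_varphi:
  assumes v: "linear_functional v" and b: "linear_functional b" and \<pi>: "Polynomial.degree \<pi> = N"
    and dual: "(fderiv ^^ k) b =
      smult ((- 1) ^ k * pochhammer (of_nat (n + 1)) k / v ((Q (n + k))\<^sup>2)) (Q (n + k)) \<odot> v"
    and "k + N \<le> m"
  shows "(fderiv ^^ m) (\<pi> \<odot> b) p = (\<Sum>i\<le>m - k. (fderiv ^^ i) v (varphi v Q \<pi> N m k n i * p))"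
proof -
  define r where "r = m - k - N"
  define V where "V j = (fderiv ^^ j) v" for j
  note V = linear_functional_fderiv_pow[OF v, folded V_def]
  define T where "T = (\<lambda>(j, l). of_nat (r choose l) *
    V (j + l) ((pderiv ^^ (r - l)) (phi v Q \<pi> N k n j) * p))"
  have V_add: "(fderiv ^^ l) (V j) = V (j + l)" for j l
    by (simp add: V_def add.commute[of j] funpow_add)
  have m: "m = r + (k + N)" using \<open>k + N \<le> m\<close> by (simp add: r_def)
  \<comment> \<open>The outer \<open>r\<close> derivatives move onto the test polynomial so that the
    expansion of order \<open>k + N\<close> applies pointwise; the next step moves them
    back.\<close>
  have "(fderiv ^^ m) (\<pi> \<odot> b) p = (- 1) ^ r * (fderiv ^^ (k + N)) (\<pi> \<odot> b) ((pderiv ^^ r) p)"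
    unfolding m funpow_add o_apply by (rule fderiv_pow)
  also have "\<dots> = (\<Sum>j\<le>N. (fderiv ^^ r) (phi v Q \<pi> N k n j \<odot> V j) p)"
    unfolding fderiv_pow_dual_phi[where Q = Q and n = n, OF v b \<pi> dual]
    by (simp add: fderiv_pow[of r] fmult_def sum_distrib_left V_def)
  also have "\<dots> = (\<Sum>j\<le>N. \<Sum>l\<le>r. T (j, l))"
    by (simp add: fderiv_pow_fmult[OF V] T_def V_add)
  also have "\<dots> = (\<Sum>x\<in>{..N} \<times> {..r}. T x)"
    by (simp add: sum.cartesian_product)
  also have "\<dots> = (\<Sum>i\<le>m - k. \<Sum>x | x \<in> {..N} \<times> {..r} \<and> (case x of (j, l) \<Rightarrow> j + l) = i. T x)"
    by (rule sum.group[symmetric]) (auto simp: m)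
  also have "\<dots> = (\<Sum>i\<le>m - k. V i (varphi v Q \<pi> N m k n i * p))"
  proof (intro sum.cong refl)
    fix i
    let ?S = "{(j, l). j + l = i \<and> j \<le> N \<and> l \<le> r}"
    have "V i (varphi v Q \<pi> N m k n i * p) =
        (\<Sum>(j, l)\<in>?S. of_nat (r choose l) * V i ((pderiv ^^ (r - l)) (phi v Q \<pi> N k n j) * p))"
      by (simp add: varphi_def r_def sum_distrib_right functional_sum[OF V]
          functional_simps[OF V] mult.assoc case_prod_unfold)
    also have "\<dots> = (\<Sum>x\<in>?S. T x)"
      by (intro sum.cong) (auto simp: T_def)
    also have "?S = {x \<in> {..N} \<times> {..r}. (case x of (j, l) \<Rightarrow> j + l) = i}"
      by auto
    finally show "(\<Sum>x | x \<in> {..N} \<times> {..r} \<and> (case x of (j, l) \<Rightarrow> j + l) = i. T x) =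
        V i (varphi v Q \<pi> N m k n i * p)" ..
  qed
  finally show ?thesis by (simp add: V_def)
qed

section \<open>Solving the linear system and deriving the Pearson equations\<close>

text \<open>Equation \<open>n\<close> is tested with \<open>cofactor B n i * p\<close> and the
  equations are added. The adjugate identity isolates \<open>V i\<close> without any division, so
  Cramer's rule works for polynomials acting on functionals.\<close>

lemma functional_cramer:
  fixes V :: "nat \<Rightarrow> complex poly \<Rightarrow> complex"
  assumes B: "B \<in> carrier_mat d d" and V: "\<And>i. linear_functional (V i)"
    and u: "linear_functional u" and "i < d"
    and system: "\<And>n p. n < d \<Longrightarrow> (\<Sum>j<d. V j (B $$ (n, j) * p)) = u (y $ n * p)"
  shows "det B \<odot> V i = det (replace_col B y i) \<odot> u"
proof
  fix p
  have adj: "(\<Sum>n<d. cofactor B n i * B $$ (n, j)) = (if j = i then det B else 0)" if "j < d" for j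
  proof -
    have "(\<Sum>n<d. cofactor B n i * B $$ (n, j)) = (adj_mat B * B) $$ (i, j)"
      using B \<open>i < d\<close> that
      by (auto simp: adj_mat_def scalar_prod_def atLeast0LessThan intro!: sum.cong)
    also have "\<dots> = (if j = i then det B else 0)"
      using adj_mat(3)[OF B] \<open>i < d\<close> that by simp
    finally show ?thesis .
  qed
  have replace: "replace_col B y i \<in> carrier_mat d d"
    using B by (simp add: replace_col_def)
  \<comment> \<open>Cofactors along column \<open>i\<close> delete that column, so replacing it
    leaves them unchanged.\<close>
  have "cofactor (replace_col B y i) n i = cofactor B n i" if "n < d" for n
    using B that \<open>i < d\<close>
    by (auto simp: cofactor_def mat_delete_def replace_col_def
        intro!: arg_cong[of _ _ det] arg_cong[of _ _ "\<lambda>x. _ * x"] eq_matI)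
  then have det: "det (replace_col B y i) = (\<Sum>n<d. y $ n * cofactor B n i)"
    unfolding laplace_expansion_column[OF replace \<open>i < d\<close>]
    using B \<open>i < d\<close> by (intro sum.cong) (auto simp: replace_col_def)
  have "V i (det B * p) = (\<Sum>j<d. if j = i then V j (det B * p) else 0)"
    using \<open>i < d\<close> by simp
  also have "\<dots> = (\<Sum>j<d. V j ((\<Sum>n<d. cofactor B n i * B $$ (n, j)) * p))"
    by (intro sum.cong) (auto simp: adj functional_simps[OF V])
  also have "\<dots> = (\<Sum>n<d. \<Sum>j<d. V j (B $$ (n, j) * (cofactor B n i * p)))"
    by (subst sum.swap) (simp add: sum_distrib_right sum_distrib_left functional_sum[OF V] mult_ac)
  also have "\<dots> = (\<Sum>n<d. u (y $ n * (cofactor B n i * p)))"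
    by (intro sum.cong) (auto simp: system)
  also have "\<dots> = u (det (replace_col B y i) * p)"
    by (simp add: det sum_distrib_right functional_sum[OF u] mult.assoc)
  finally show "(det B \<odot> V i) p = (det (replace_col B y i) \<odot> u) p"
    by (simp add: fmult_def)
qed

theorem theorem2p1:
  fixes M N m k :: nat
    and \<pi> A A\<^sub>1 A\<^sub>2 :: "complex poly"
    and P Q :: "nat \<Rightarrow> complex poly"
    and c :: "nat \<Rightarrow> nat \<Rightarrow> complex"
    and u v :: "complex poly \<Rightarrow> complex"
  assumes "lead_coeff \<pi> = 1" and "degree \<pi> = N"
    and "coherent_pair \<pi> N M m k P Q c"
    and "monic_OPS u P" and "monic_OPS v Q"
    and "m \<ge> k + N" and "N = 0 \<longrightarrow> m > k"
    and "A = det (varphi_mat v Q \<pi> N m k)"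
    and "A\<^sub>1 = det (replace_col (varphi_mat v Q \<pi> N m k) (psi_vec u P c N M m k) 0)"
    and "A\<^sub>2 = det (replace_col (varphi_mat v Q \<pi> N m k) (psi_vec u P c N M m k) 1)"
    and "A \<noteq> 0"
  shows "A \<odot> v = A\<^sub>1 \<odot> u
    \<and> A \<odot> fderiv v = A\<^sub>2 \<odot> u
    \<and> semiclassical u \<and> semiclassical v \<and> rationally_related u v
    \<and> fderiv ((A * A\<^sub>1) \<odot> u) = (2 * pderiv A * A\<^sub>1 + A * A\<^sub>2) \<odot> u
    \<and> fderiv ((A * A\<^sub>1) \<odot> v) = (pderiv (A * A\<^sub>1) + A * A\<^sub>2) \<odot> v"
proof -
  note OPS_u = \<open>monic_OPS u P\<close> and OPS_v = \<open>monic_OPS v Q\<close>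
  note u = monic_OPS_linear[OF OPS_u] and v = monic_OPS_linear[OF OPS_v]
  let ?B = "varphi_mat v Q \<pi> N m k" and ?y = "psi_vec u P c N M m k"
  have system: "(\<Sum>i\<le>m - k. (fderiv ^^ i) v (varphi v Q \<pi> N m k n i * p)) =
      u (psi u P c N M m n * p)" for n p
  proof -
    obtain b where b: "linear_functional b" "\<And>j. b (nderiv k Q j) = (if j = n then 1 else 0)"
      and dual: "(fderiv ^^ k) b =
        smult ((- 1) ^ k * pochhammer (of_nat (n + 1)) k / v ((Q (n + k))\<^sup>2)) (Q (n + k)) \<odot> v"
      using nderiv_dual_functional[OF OPS_v] by blast
    show ?thesis
      using fderiv_pow_dual_varphi[where Q = Q and n = n, OF v b(1) \<open>Polynomial.degree \<pi> = N\<close> dual \<open>k + N \<le> m\<close>]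
        fderiv_pow_coherent_dual[OF \<open>coherent_pair \<pi> N M m k P Q c\<close> OPS_u b]
      by (simp add: fmult_def)
  qed
  have cramer: "A \<odot> (fderiv ^^ i) v = det (replace_col ?B ?y i) \<odot> u" if "i \<le> m - k" for i
    unfolding \<open>A = det ?B\<close>
  proof (rule functional_cramer[where d = "m - k + 1", OF _ linear_functional_fderiv_pow[OF v] u])
    show "(\<Sum>j<m - k + 1. (fderiv ^^ j) v (?B $$ (n, j) * p)) = u (?y $ n * p)"
      if "n < m - k + 1" for n p
      using system[where n = n and p = p] that
      by (simp add: varphi_mat_def psi_vec_def lessThan_Suc_atMost)
  qed (use that in \<open>auto simp: varphi_mat_def\<close>)
  \<comment> \<open>Guarantees that the matrix has a second column, so that Cramer's rule also
    applies to \<open>fderiv v\<close>.\<close>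
  have "1 \<le> m - k" using assms(6,7) by linarith
  from cramer[of 0] have Av: "A \<odot> v = A\<^sub>1 \<odot> u" by (simp add: assms(9))
  from cramer[OF \<open>1 \<le> m - k\<close>] have ADv: "A \<odot> fderiv v = A\<^sub>2 \<odot> u" by (simp add: assms(10))
  have Av': "v (A * p) = u (A\<^sub>1 * p)" and ADv': "fderiv v (A * p) = u (A\<^sub>2 * p)" for p
    using fun_cong[OF Av] fun_cong[OF ADv] by (simp_all add: fmult_def)
  \<comment> \<open>If \<open>A\<^sub>1\<close> were zero, \<open>A \<odot> v\<close> would vanish,
    forcing \<open>A = 0\<close>.\<close>
  have "A\<^sub>1 \<noteq> 0"
    using monic_OPS_torsion_free[OF OPS_v, of A] \<open>A \<noteq> 0\<close> Av'
    by (auto simp: functional_simps[OF u])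
  have Pearson_u: "fderiv ((A * A\<^sub>1) \<odot> u) = (2 * pderiv A * A\<^sub>1 + A * A\<^sub>2) \<odot> u"
  proof
    fix p
    \<comment> \<open>Passing to \<open>v\<close> makes the Leibniz rule yield only \<open>v\<close>
      and \<open>fderiv v\<close>, each with a factor \<open>A\<close> that converts it back to
      \<open>u\<close>.\<close>
    have "(A * A\<^sub>1) \<odot> u = (A * A) \<odot> v"
      using Av'[of "A * _"] by (simp add: fmult_def mult_ac)
    then have "fderiv ((A * A\<^sub>1) \<odot> u) p = v (A * (2 * pderiv A * p)) + fderiv v (A * (A * p))"
      by (simp add: fderiv_fmult[OF v]) (simp add: fmult_def pderiv_mult algebra_simps)
    then show "fderiv ((A * A\<^sub>1) \<odot> u) p = ((2 * pderiv A * A\<^sub>1 + A * A\<^sub>2) \<odot> u) p"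
      by (simp add: Av' ADv' fmult_def functional_simps(2)[OF u, symmetric] algebra_simps)
  qed
  have Pearson_v: "fderiv ((A * A\<^sub>1) \<odot> v) = (pderiv (A * A\<^sub>1) + A * A\<^sub>2) \<odot> v"
  proof
    fix p
    have "fderiv ((A * A\<^sub>1) \<odot> v) p = v (pderiv (A * A\<^sub>1) * p) + fderiv v (A * (A\<^sub>1 * p))"
      by (simp add: fderiv_fmult[OF v]) (simp add: fmult_def mult_ac)
    \<comment> \<open>Both sides equal \<open>u (A\<^sub>1 * A\<^sub>2 * p)\<close>, by the two
      Cramer identities.\<close>
    also have "fderiv v (A * (A\<^sub>1 * p)) = v (A * (A\<^sub>2 * p))"
      by (simp add: Av' ADv' mult_ac)
    finally show "fderiv ((A * A\<^sub>1) \<odot> v) p = ((pderiv (A * A\<^sub>1) + A * A\<^sub>2) \<odot> v) p"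
      by (simp add: fmult_def functional_simps(2)[OF v] distrib_right mult.assoc)
  qed
  have "A * A\<^sub>1 \<noteq> 0" using \<open>A \<noteq> 0\<close> \<open>A\<^sub>1 \<noteq> 0\<close> by simp
  then have "semiclassical u" "semiclassical v"
    using monic_OPS_semiclassicalI[OF OPS_u _ Pearson_u]
      monic_OPS_semiclassicalI[OF OPS_v _ Pearson_v] by blast+
  moreover have "rationally_related u v"
    using Av \<open>A \<noteq> 0\<close> \<open>A\<^sub>1 \<noteq> 0\<close> unfolding rationally_related_def by metis
  ultimately show ?thesis using Av ADv Pearson_u Pearson_v by blast
qed

end
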